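(* Let $(E_7)^{\iota}=\{\alpha\in E_7\mid\iota\alpha\iota^{-1}=\alpha\}$ and $(E_7)^{\lambda}=\{\alpha\in E_7\mid\lambda\alpha\lambda^{-1}=\alpha\}$. Then $$(E_7)^{\iota}\cap (E_7)^{\lambda}\;\cong\;F_4\times\mathcal{Z}_2,\qquad\mathcal{Z}_2=\{1,-1\}.$$
   Context: Let $\mathfrak{C}$ be the division Cayley algebra (octonions), $\mathfrak{J}=\{X\in M(3,\mathfrak{C})\mid X^*=X\}$, $\mathfrak{J}^C=\mathfrak{J}\oplus i\mathfrak{J}$ its complexification ($C=\mathbf{R}\oplus\mathbf{R}i$), $\tau$ the complex conjugation, $X\circ Y=\frac12(XY+YX)$, $(X,Y)=\mathrm{tr}(X\circ Y)$, $X\times Y=\frac12\big(2X\circ Y-\mathrm{tr}(X)Y-\mathrm{tr}(Y)X+(\mathrm{tr}(X)\mathrm{tr}(Y)-(X,Y))E\big)$, $\langle X,Y\rangle=(\tau X,Y)$. $F_4=\{\alpha\in\mathrm{Iso}_{\mathbf R}(\mathfrak{J})\mid\alpha(X\circ Y)=\alpha X\circ\alpha Y\}$. Let ${\mathfrak{e}_6}^C=\{\phi\in\mathrm{Hom}_C(\mathfrak{J}^C,\mathfrak{J}^C)\mid(\phi X,X\times X)=0\}$, and ${}^t\phi$ the transpose with respect to $(X,Y)$. For $X,W\in\mathfrak{J}^C$ define $X\vee W\in{\mathfrak{e}_6}^C$ by $(X\vee W)U=\frac12(W,U)X+\frac16(X,W)U-2W\times(X\times U)$. Let $\mathfrak{P}^C=\mathfrak{J}^C\oplus\mathfrak{J}^C\oplus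 C\oplus C$ with $\langle P,Q\rangle=\langle X,Z\rangle+\langle Y,W\rangle+(\tau\xi)\zeta+(\tau\eta)\omega$ for $P=(X,Y,\xi,\eta)$, $Q=(Z,W,\zeta,\omega)$. For $\phi\in{\mathfrak{e}_6}^C$, $A,B\in\mathfrak{J}^C$, $\nu\in C$ define $\varPhi(\phi,A,B,\nu):\mathfrak{P}^C\to\mathfrak{P}^C$ by $(X,Y,\xi,\eta)\mapsto(\phi X-\frac13\nu X+2B\times Y+\eta A,\ 2A\times X-{}^t\phi Y+\frac13\nu Y+\xi B,\ (A,Y)+\nu\xi,\ (B,X)-\nu\eta)$. Define $P\times Q=\varPhi(\phi,A,B,\nu)$ with $\phi=-\frac12(X\vee W+Z\vee Y)$, $A=-\frac14(2Y\times W-\xi Z-\zeta X)$, $B=\frac14(2X\times Z-\eta W-\omega Y)$, $\nu=\frac18((X,W)+(Z,Y)-3(\xi\omega+\zeta\eta))$. Then $E_7=\{\alpha\in\mathrm{Iso}_C(\mathfrak{P}^C)\mid\alpha(P\times Q)\alpha^{-1}=\alpha P\times\alpha Q,\ \langle\alpha P,\alpha Q\rangle=\langle P,Q\rangle\}$. Elements of $E_7$: $\lambda(X,Y,\xi,\eta)=(Y,-X,\eta,-\xi)$; $\iota(X,Y,\xi,\eta)=(-iX,iY,-i\xi,i\eta)$; $-1$ denotes the central element $-\mathrm{id}$. *)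

theory Defs
  imports "HOL-Analysis.Analysis" "HOL-Algebra.Group"
begin

text \<open>
  The Cayley--Dickson doublings of the complex numbers: quaternions as pairs of complex numbers,
  octonions as pairs of quaternions, both with
  \<open>(a, b) (c, d) = (a c - d* b, d a + b c*)\<close> and \<open>(a, b)* = (a*, -b)\<close>.
  The real vector space structure and the norm are those of the product types.
\<close>

type_synonym quaternion = "complex \<times> complex"
type_synonym octonion = "quaternion \<times> quaternion"

definition qconj :: "quaternion \<Rightarrow> quaternion" where
  "qconj p = (cnj (fst p), - snd p)"

definition qmult :: "quaternion \<Rightarrow> quaternion \<Rightarrow> quaternion" where
  "qmult p q = (fst p * fst q - cnj (snd q) * snd p, snd q * fst p + snd p * cnj (fst q))"

definition oconj :: "octonion \<Rightarrow> octonion" where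
  "oconj x = (qconj (fst x), - snd x)"

definition omult :: "octonion \<Rightarrow> octonion \<Rightarrow> octonion" where
  "omult x y =
     (qmult (fst x) (fst y) - qmult (qconj (snd y)) (snd x),
      qmult (snd y) (fst x) + qmult (snd x) (qconj (fst y)))"

definition ore :: "octonion \<Rightarrow> real" where
  "ore x = Re (fst (fst x))"

lemma norm_omult: "norm (omult x y) = norm x * norm y"
proof -
  have "(norm (omult x y))\<^sup>2 = (norm x * norm y)\<^sup>2"
    by (cases x; cases y; simp only: split_paired_all)
       (simp add: omult_def qmult_def qconj_def norm_Pair cmod_power2 power_mult_distrib,
        simp add: power2_eq_square algebra_simps)
  then show ?thesis
    by (simp add: power2_eq_iff_nonneg)
qed

text \<open>
  Octonion matrices. The library product \<open>**\<close> needs an associative entry type.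
\<close>

definition omat_mult :: "octonion^3^3 \<Rightarrow> octonion^3^3 \<Rightarrow> octonion^3^3" where
  "omat_mult X Y = (\<chi> i j. \<Sum>k\<in>UNIV. omult (X $ i $ k) (Y $ k $ j))"

definition omat_star :: "octonion^3^3 \<Rightarrow> octonion^3^3" where
  "omat_star X = (\<chi> i j. oconj (X $ j $ i))"

definition omat_one :: "octonion^3^3" where
  "omat_one = (\<chi> i j. if i = j then ((1, 0), (0, 0)) else 0)"

lemma oconj_linear [simp]:
  "oconj 0 = 0" "oconj (x + y) = oconj x + oconj y" "oconj (x - y) = oconj x - oconj y"
  "oconj (- x) = - oconj x" "oconj (r *\<^sub>R x) = r *\<^sub>R oconj x"
  by (auto simp: oconj_def qconj_def prod_eq_iff)

lemma oconj_sum: "oconj (sum f A) = (\<Sum>k\<in>A. oconj (f k))"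
  by (induction A rule: infinite_finite_induct) auto

lemma oconj_omult: "oconj (omult x y) = omult (oconj y) (oconj x)"
  by (simp add: omult_def oconj_def qmult_def qconj_def prod_eq_iff algebra_simps)

lemma omat_star_linear [simp]:
  "omat_star 0 = 0" "omat_star (X + Y) = omat_star X + omat_star Y"
  "omat_star (X - Y) = omat_star X - omat_star Y" "omat_star (- X) = - omat_star X"
  "omat_star (r *\<^sub>R X) = r *\<^sub>R omat_star X"
  by (simp_all add: omat_star_def vec_eq_iff)

lemma omat_star_mult: "omat_star (omat_mult X Y) = omat_mult (omat_star Y) (omat_star X)"
  by (simp add: omat_star_def omat_mult_def vec_eq_iff oconj_sum oconj_omult)

lemma omat_star_one: "omat_star omat_one = omat_one"
  by (simp add: omat_star_def omat_one_def vec_eq_iff) (simp add: oconj_def qconj_def)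

text \<open>The real vector space of Hermitian octonion matrices of size 3.\<close>

typedef jordan = "{X :: octonion^3^3. omat_star X = X}"
  morphisms mat_of Jordan
  by (rule exI[of _ 0]) simp

setup_lifting type_definition_jordan

instantiation jordan :: real_vector
begin

lift_definition zero_jordan :: jordan is 0 by simp
lift_definition plus_jordan :: "jordan \<Rightarrow> jordan \<Rightarrow> jordan" is "(+)" by simp
lift_definition minus_jordan :: "jordan \<Rightarrow> jordan \<Rightarrow> jordan" is "(-)" by simp
lift_definition uminus_jordan :: "jordan \<Rightarrow> jordan" is uminus by simp
lift_definition scaleR_jordan :: "real \<Rightarrow> jordan \<Rightarrow> jordan" is "(*\<^sub>R)" by simp

instance
  by standard (transfer, simp add: algebra_simps)+

end

lift_definition jprod :: "jordan \<Rightarrow> jordan \<Rightarrow> jordan" is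
  "\<lambda>X Y. (1/2) *\<^sub>R (omat_mult X Y + omat_mult Y X)"
  by (simp add: omat_star_mult add.commute)

lift_definition jone :: jordan is omat_one
  by (rule omat_star_one)

text \<open>The diagonal entries of a Hermitian matrix are real octonions, so the trace is a real number.\<close>

lift_definition jtr :: "jordan \<Rightarrow> real" is "\<lambda>X. \<Sum>i\<in>UNIV. ore (X $ i $ i)" .

definition F4 :: "(jordan \<Rightarrow> jordan) set" where
  "F4 = {\<alpha>. linear \<alpha> \<and> bij \<alpha> \<and> (\<forall>X Y. \<alpha> (jprod X Y) = jprod (\<alpha> X) (\<alpha> Y))}"

text \<open>
  The complexification: the pair \<open>(X, Y)\<close> stands for \<open>X + i Y\<close>. The Jordan product and the
  trace are extended complex bilinearly and complex linearly, \<open>cxconj\<close> is the complex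
  conjugation \<open>\<tau>\<close> (not the conjugation of the octonions).
\<close>

type_synonym jordanC = "jordan \<times> jordan"

definition cmul :: "complex \<Rightarrow> jordanC \<Rightarrow> jordanC" where
  "cmul c X = (Re c *\<^sub>R fst X - Im c *\<^sub>R snd X, Re c *\<^sub>R snd X + Im c *\<^sub>R fst X)"

definition cxconj :: "jordanC \<Rightarrow> jordanC" where
  "cxconj X = (fst X, - snd X)"

definition cprod :: "jordanC \<Rightarrow> jordanC \<Rightarrow> jordanC" where
  "cprod X Y =
     (jprod (fst X) (fst Y) - jprod (snd X) (snd Y), jprod (fst X) (snd Y) + jprod (snd X) (fst Y))"

definition ctr :: "jordanC \<Rightarrow> complex" where
  "ctr X = Complex (jtr (fst X)) (jtr (snd X))"

definition cone :: jordanC where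
  "cone = (jone, 0)"

definition cinner :: "jordanC \<Rightarrow> jordanC \<Rightarrow> complex" where
  "cinner X Y = ctr (cprod X Y)"

definition cherm :: "jordanC \<Rightarrow> jordanC \<Rightarrow> complex" where
  "cherm X Y = cinner (cxconj X) Y"

text \<open>The Freudenthal product \<open>X \<times> Y\<close>.\<close>

definition ccross :: "jordanC \<Rightarrow> jordanC \<Rightarrow> jordanC" where
  "ccross X Y = cmul (1/2)
     (cmul 2 (cprod X Y) - cmul (ctr X) Y - cmul (ctr Y) X
        + cmul (ctr X * ctr Y - cinner X Y) cone)"

text \<open>The operator \<open>X \<or> W\<close>.\<close>

definition cvee :: "jordanC \<Rightarrow> jordanC \<Rightarrow> jordanC \<Rightarrow> jordanC" where
  "cvee X W U =
     cmul (1/2 * cinner W U) X + cmul (1/6 * cinner X W) U - cmul 2 (ccross W (ccross X U))"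

text \<open>
  The transpose with respect to the bilinear form. The form is nondegenerate, so for a complex
  linear map the description is satisfied by exactly one map.
\<close>

definition ctransp :: "(jordanC \<Rightarrow> jordanC) \<Rightarrow> jordanC \<Rightarrow> jordanC" where
  "ctransp \<phi> = (THE \<psi>. \<forall>X Y. cinner (\<phi> X) Y = cinner X (\<psi> Y))"

type_synonym freud = "jordanC \<times> jordanC \<times> complex \<times> complex"

fun pmul :: "complex \<Rightarrow> freud \<Rightarrow> freud" where
  "pmul c (X, Y, \<xi>, \<eta>) = (cmul c X, cmul c Y, c * \<xi>, c * \<eta>)"

text \<open>
  The predicate \<open>Vector_Spaces.linear\<close> includes the vector space axioms for the scalar
  multiplications it is given.
\<close>

lemma vector_space_cmul: "vector_space cmul"
  by standard (auto simp: cmul_def prod_eq_iff algebra_simps)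

lemma vector_space_pmul: "vector_space pmul"
proof -
  have "cmul c (X + Y) = cmul c X + cmul c Y" "cmul (c + d) X = cmul c X + cmul d X"
    "cmul c (cmul d X) = cmul (c * d) X" "cmul 1 X = X" for c d X Y
    by (auto simp: cmul_def prod_eq_iff algebra_simps)
  then show ?thesis
    by unfold_locales (simp_all only: split_paired_all pmul.simps plus_prod_def fst_conv snd_conv
        distrib_left distrib_right mult.assoc mult_1)
qed

fun pherm :: "freud \<Rightarrow> freud \<Rightarrow> complex" where
  "pherm (X, Y, \<xi>, \<eta>) (Z, W, \<zeta>, \<omega>) = cherm X Z + cherm Y W + cnj \<xi> * \<zeta> + cnj \<eta> * \<omega>"

text \<open>
  The map \<open>\<Phi>(\<phi>, A, B, \<nu>)\<close> is of interest for \<open>\<phi>\<close> in the complex Lie algebra of type E6 only. In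
  the definition of \<open>P \<times> Q\<close> it is applied to combinations of operators \<open>X \<or> W\<close>, which lie there.
\<close>

fun Phi :: "(jordanC \<Rightarrow> jordanC) \<Rightarrow> jordanC \<Rightarrow> jordanC \<Rightarrow> complex \<Rightarrow> freud \<Rightarrow> freud" where
  "Phi \<phi> A B \<nu> (X, Y, \<xi>, \<eta>) =
     (\<phi> X - cmul (1/3 * \<nu>) X + cmul 2 (ccross B Y) + cmul \<eta> A,
      cmul 2 (ccross A X) - ctransp \<phi> Y + cmul (1/3 * \<nu>) Y + cmul \<xi> B,
      cinner A Y + \<nu> * \<xi>,
      cinner B X - \<nu> * \<eta>)"

fun pcross :: "freud \<Rightarrow> freud \<Rightarrow> freud \<Rightarrow> freud" where
  "pcross (X, Y, \<xi>, \<eta>) (Z, W, \<zeta>, \<omega>) =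
     Phi (\<lambda>U. cmul (- (1/2)) (cvee X W U + cvee Z Y U))
         (cmul (- (1/4)) (cmul 2 (ccross Y W) - cmul \<xi> Z - cmul \<zeta> X))
         (cmul (1/4) (cmul 2 (ccross X Z) - cmul \<eta> W - cmul \<omega> Y))
         (1/8 * (cinner X W + cinner Z Y - 3 * (\<xi> * \<omega> + \<zeta> * \<eta>)))"

definition E7 :: "(freud \<Rightarrow> freud) set" where
  "E7 = {\<alpha>. Vector_Spaces.linear pmul pmul \<alpha> \<and> bij \<alpha>
        \<and> (\<forall>P Q. \<alpha> \<circ> pcross P Q \<circ> inv_into UNIV \<alpha> = pcross (\<alpha> P) (\<alpha> Q))
        \<and> (\<forall>P Q. pherm (\<alpha> P) (\<alpha> Q) = pherm P Q)}"

fun lam :: "freud \<Rightarrow> freud" where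
  "lam (X, Y, \<xi>, \<eta>) = (Y, - X, \<eta>, - \<xi>)"

fun iota :: "freud \<Rightarrow> freud" where
  "iota (X, Y, \<xi>, \<eta>) = (cmul (- \<i>) X, cmul \<i> Y, - \<i> * \<xi>, \<i> * \<eta>)"

definition E7_fix :: "(freud \<Rightarrow> freud) \<Rightarrow> (freud \<Rightarrow> freud) set" where
  "E7_fix \<sigma> = {\<alpha> \<in> E7. \<sigma> \<circ> \<alpha> \<circ> inv_into UNIV \<sigma> = \<alpha>}"

definition Z2 :: "(freud \<Rightarrow> freud) set" where
  "Z2 = {id, uminus}"

definition map_group :: "('a \<Rightarrow> 'a) set \<Rightarrow> ('a \<Rightarrow> 'a) monoid" where
  "map_group S = \<lparr>carrier = S, mult = (\<circ>), one = id\<rparr>"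

end

theory Submission
  imports Defs
begin

text \<open>
  The \<open>\<iota>\<close>-eigenspaces are \<open>{(X, 0, \<xi>, 0)}\<close> and \<open>{(0, Y, 0, \<eta>)}\<close>, and \<open>\<lambda>\<close> interchanges them, so an
  element of the intersection is determined by a map \<open>(X, \<xi>) \<mapsto> (f X + \<xi> p, g X + \<xi> c)\<close>. Since
  \<open>P \<times> P = 0\<close> for \<open>P = (0, 0, 1, 0)\<close>, we get \<open>c p = 0\<close> and \<open>p \<times> p = 0\<close>. If \<open>c\<close> vanished, then
  \<open>(p, p) = \<langle>p, p\<rangle> = 1\<close>, so \<open>p\<close> would be real; but a nonzero real \<open>p\<close> with \<open>p \<times> p = 0\<close> has some
  \<open>X \<notin> \<real> p\<close> with \<open>p \<times> X = 0\<close>, while only multiples of \<open>P\<close> in its eigenspace annihilate \<open>P\<close>. Hence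
  \<open>p = 0\<close>, \<open>g = 0\<close> and \<open>c = \<plusminus>1\<close>, and \<open>c f\<close> preserves the Freudenthal product, the bilinear and the
  Hermitian form. It therefore commutes with \<open>\<tau>\<close>, and its real part fixes the unit matrix, hence
  lies in \<open>F\<^sub>4\<close>. Conversely an element of \<open>F\<^sub>4\<close> preserves the trace, because the matrices of
  trace zero are sums of associators, and so all the structure from which \<open>P \<times> Q\<close> is built.
\<close>

section \<open>Coordinates on the Jordan algebra\<close>

definition oreal :: "real \<Rightarrow> octonion" where
  "oreal r = ((of_real r, 0), (0, 0))"

lemma oconj_oreal [simp]: "oconj (oreal r) = oreal r"
  by (simp add: oreal_def oconj_def qconj_def)

lemma oconj_oconj [simp]: "oconj (oconj x) = x"
  by (simp add: oconj_def qconj_def prod_eq_iff)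

text \<open>Labels are cyclic: \<open>x\<close>, \<open>y\<close>, \<open>z\<close> stand opposite
  \<open>a\<close>, \<open>b\<close>, \<open>c\<close>, so product formulas are stable under a
  simultaneous shift of both triples.\<close>

lift_definition jmk :: "real \<Rightarrow> real \<Rightarrow> real \<Rightarrow> octonion \<Rightarrow> octonion \<Rightarrow> octonion \<Rightarrow> jordan" is
  "\<lambda>a b c x y z. vector [vector [oreal a, z, oconj y], vector [oconj z, oreal b, x],
     vector [y, oconj x, oreal c]]"
  by (simp add: omat_star_def vec_eq_iff forall_3)

lemma oconj_fixed: "oconj x = x \<Longrightarrow> x = oreal (ore x)"
  by (auto simp: oconj_def qconj_def oreal_def ore_def prod_eq_iff complex_eq_iff)

lemma jordan_cases [cases type: jordan]:
  obtains a b c x y z where "X = jmk a b c x y z"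
proof -
  have s: "oconj (mat_of X $ j $ i) = mat_of X $ i $ j" for i j
    using mat_of[of X] by (simp add: omat_star_def vec_eq_iff)
  have d: "mat_of X $ i $ i = oreal (ore (mat_of X $ i $ i))" for i
    by (rule oconj_fixed) (rule s)
  have "X = jmk (ore (mat_of X $ 1 $ 1)) (ore (mat_of X $ 2 $ 2)) (ore (mat_of X $ 3 $ 3))
    (mat_of X $ 2 $ 3) (mat_of X $ 3 $ 1) (mat_of X $ 1 $ 2)"
    unfolding mat_of_inject[symmetric] jmk.rep_eq
    by (simp add: vec_eq_iff forall_3 s d[symmetric])
  then show thesis by (rule that)
qed

lemma jmk_eq_iff [simp]:
  "jmk a b c x y z = jmk a' b' c' x' y' z' \<longleftrightarrow>
     a = a' \<and> b = b' \<and> c = c' \<and> x = x' \<and> y = y' \<and> z = z'"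
  by transfer (auto simp: vec_eq_iff forall_3 oreal_def)

lemma oreal_linear:
  "oreal a + oreal b = oreal (a + b)" "oreal a - oreal b = oreal (a - b)"
  "- oreal a = oreal (- a)" "r *\<^sub>R oreal a = oreal (r * a)" "oreal 0 = 0"
  by (simp_all add: oreal_def prod_eq_iff scaleR_conv_of_real)

lemma jmk_linear:
  "jmk a b c x y z + jmk a' b' c' x' y' z' = jmk (a + a') (b + b') (c + c') (x + x') (y + y') (z + z')"
  "jmk a b c x y z - jmk a' b' c' x' y' z' = jmk (a - a') (b - b') (c - c') (x - x') (y - y') (z - z')"
  "- jmk a b c x y z = jmk (- a) (- b) (- c) (- x) (- y) (- z)"
  "r *\<^sub>R jmk a b c x y z = jmk (r * a) (r * b) (r * c) (r *\<^sub>R x) (r *\<^sub>R y) (r *\<^sub>R z)"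
  by (transfer; simp add: vec_eq_iff forall_3 oreal_linear)+

lemma jmk_const: "0 = jmk 0 0 0 0 0 0" "jone = jmk 1 1 1 0 0 0"
  by (transfer; simp add: vec_eq_iff forall_3 oreal_linear oreal_def[of 1] omat_one_def)+

lemma jtr_jmk [simp]: "jtr (jmk a b c x y z) = a + b + c"
  by transfer (simp add: sum_3 oreal_def ore_def)

lemma jprod_jmk:
  "jprod (jmk a b c x y z) (jmk a' b' c' x' y' z') =
     jmk (a * a' + y \<bullet> y' + z \<bullet> z') (b * b' + z \<bullet> z' + x \<bullet> x') (c * c' + x \<bullet> x' + y \<bullet> y')
       ((1/2) *\<^sub>R ((b + c) *\<^sub>R x' + (b' + c') *\<^sub>R x + oconj (omult y z' + omult y' z)))
       ((1/2) *\<^sub>R ((c + a) *\<^sub>R y' + (c' + a') *\<^sub>R y + oconj (omult z x' + omult z' x)))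
       ((1/2) *\<^sub>R ((a + b) *\<^sub>R z' + (a' + b') *\<^sub>R z + oconj (omult x y' + omult x' y)))"
  by (transfer, simp add: vec_eq_iff forall_3 omat_mult_def sum_3)
    (simp add: prod_eq_iff complex_eq_iff omult_def qmult_def oconj_def qconj_def oreal_def
      inner_complex_def inner_prod_def algebra_simps)

lemma omult_linear:
  "omult (x + y) z = omult x z + omult y z" "omult z (x + y) = omult z x + omult z y"
  "omult (r *\<^sub>R x) z = r *\<^sub>R omult x z" "omult z (r *\<^sub>R x) = r *\<^sub>R omult z x"
  "omult 0 z = 0" "omult z 0 = 0"
  by (simp_all add: omult_def qmult_def qconj_def prod_eq_iff complex_eq_iff algebra_simps)

text \<open>Octonions do not associate, but the real part of a triple product still behaves like a
  trace.\<close>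

lemma ore_cyclic: "ore (omult (omult x y) z) = ore (omult (omult y z) x)"
  by (simp add: omult_def qmult_def qconj_def ore_def algebra_simps)

lemma jprod_commute: "jprod X Y = jprod Y X"
  by transfer (simp add: add.commute)

lemma jprod_add: "jprod (X + Y) Z = jprod X Z + jprod Y Z"
  by transfer (simp add: omat_mult_def vec_eq_iff omult_linear sum.distrib scaleR_add_right)

lemma jprod_scaleR: "jprod (r *\<^sub>R X) Z = r *\<^sub>R jprod X Z"
  by transfer (simp add: omat_mult_def vec_eq_iff omult_linear scaleR_sum_right scaleR_add_right
     mult.commute)

lemma jtr_linear [simp]: "jtr (X + Y) = jtr X + jtr Y" "jtr (r *\<^sub>R X) = r * jtr X"
  by (cases X; cases Y; simp add: jmk_linear algebra_simps)+

lemma inner_oconj_omult: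
  "x \<bullet> oconj (omult y z) = ore (omult (omult x y) z)"
  by (simp add: omult_def qmult_def qconj_def oconj_def ore_def inner_prod_def inner_complex_def algebra_simps)

lemma inner_oconj: "oconj x \<bullet> y = x \<bullet> oconj y"
  by (simp add: qconj_def oconj_def inner_prod_def inner_complex_def)

lemma jtr_assoc: "jtr (jprod (jprod X Y) Z) = jtr (jprod X (jprod Y Z))"
proof -
  obtain a b c x y z where X: "X = jmk a b c x y z" by (cases X)
  obtain a' b' c' x' y' z' where Y: "Y = jmk a' b' c' x' y' z'" by (cases Y)
  obtain a'' b'' c'' x'' y'' z'' where Z: "Z = jmk a'' b'' c'' x'' y'' z''" by (cases Z)
  have i: "oconj (omult u v) \<bullet> w = ore (omult (omult w u) v)" for u v w
    by (simp add: inner_commute inner_oconj_omult)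
  \<comment> \<open>Only factors of type \<open>y\<close> or \<open>z\<close> are rotated to the
    back, so rewriting stops with a factor of type \<open>x\<close> in front.\<close>
  show ?thesis
    by (simp add: X Y Z jprod_jmk inner_add_left inner_add_right inner_oconj_omult i
        ore_cyclic[of y] ore_cyclic[of y'] ore_cyclic[of y'']
        ore_cyclic[of z] ore_cyclic[of z'] ore_cyclic[of z''])
      (simp add: field_simps inner_commute)
qed

lemma jprod_bilinear:
  "jprod (X + Y) Z = jprod X Z + jprod Y Z" "jprod Z (X + Y) = jprod Z X + jprod Z Y"
  "jprod (r *\<^sub>R X) Z = r *\<^sub>R jprod X Z" "jprod Z (r *\<^sub>R X) = r *\<^sub>R jprod Z X"
  by (simp_all add: jprod_add jprod_scaleR jprod_commute[of Z])

section \<open>The trace form and the Freudenthal product over the reals\<close>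

definition jin :: "jordan \<Rightarrow> jordan \<Rightarrow> real" where
  "jin X Y = jtr (jprod X Y)"

lemma jin_commute: "jin X Y = jin Y X"
  by (simp add: jin_def jprod_commute)

lemma jin_bilinear:
  "jin (X + Y) Z = jin X Z + jin Y Z" "jin Z (X + Y) = jin Z X + jin Z Y"
  "jin (r *\<^sub>R X) Z = r * jin X Z" "jin Z (r *\<^sub>R X) = r * jin Z X"
  by (simp_all add: jin_def jprod_bilinear)

lemma jin_jmk [simp]:
  "jin (jmk a b c x y z) (jmk a' b' c' x' y' z') =
     a * a' + b * b' + c * c' + 2 * (x \<bullet> x' + y \<bullet> y' + z \<bullet> z')"
  by (simp add: jin_def jprod_jmk)

lemma jin_eq_0_iff: "jin X X = 0 \<longleftrightarrow> X = 0"
proof (cases X)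
  case (1 a b c x y z)
  have "0 \<le> a * a" "0 \<le> b * b" "0 \<le> c * c" "0 \<le> x \<bullet> x" "0 \<le> y \<bullet> y" "0 \<le> z \<bullet> z"
    by simp_all
  moreover have "jin X X = a * a + b * b + c * c + 2 * (x \<bullet> x) + 2 * (y \<bullet> y) + 2 * (z \<bullet> z)"
    by (simp add: 1)
  ultimately have "jin X X = 0 \<longleftrightarrow> a * a = 0 \<and> b * b = 0 \<and> c * c = 0 \<and> x \<bullet> x = 0 \<and> y \<bullet> y = 0 \<and> z \<bullet> z = 0"
    by linarith
  then show ?thesis
    by (simp add: 1 jmk_const)
qed

text \<open>The real Freudenthal product; \<open>ccross\<close> is its complex bilinear
  extension.\<close>

definition jcross :: "jordan \<Rightarrow> jordan \<Rightarrow> jordan" where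
  "jcross X Y = (1/2) *\<^sub>R (2 *\<^sub>R jprod X Y - jtr X *\<^sub>R Y - jtr Y *\<^sub>R X
     + (jtr X * jtr Y - jin X Y) *\<^sub>R jone)"

text \<open>Recovers the Jordan product, so that a linear map preserving cross product, form, trace
  and unit is multiplicative.\<close>

lemma jprod_jcross:
  "jprod X Y = jcross X Y + (1/2) *\<^sub>R (jtr X *\<^sub>R Y + jtr Y *\<^sub>R X - (jtr X * jtr Y - jin X Y) *\<^sub>R jone)"
  by (simp add: jcross_def algebra_simps)

lemma jcross_commute: "jcross X Y = jcross Y X"
  by (simp add: jcross_def jprod_commute jin_commute algebra_simps)

lemma jcross_bilinear:
  "jcross (X + Y) Z = jcross X Z + jcross Y Z" "jcross Z (X + Y) = jcross Z X + jcross Z Y"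
  "jcross (r *\<^sub>R X) Z = r *\<^sub>R jcross X Z" "jcross Z (r *\<^sub>R X) = r *\<^sub>R jcross Z X"
  by (simp_all add: jcross_def jprod_bilinear jin_bilinear algebra_simps)

lemma jprod_one: "jprod X jone = X" "jprod jone X = X"
  by (cases X; simp add: jmk_const jprod_jmk omult_linear flip: scaleR_add_left)+

lemma jin_one: "jin X jone = jtr X" "jin jone X = jtr X"
  by (simp_all add: jin_def jprod_one)

lemma jin_minus: "jin (X - Y) Z = jin X Z - jin Y Z" "jin Z (X - Y) = jin Z X - jin Z Y"
  using jin_bilinear(1)[of "X - Y" Y Z] jin_bilinear(2)[of Z "X - Y" Y] by simp_all

text \<open>Together with commutativity this makes \<open>jin (jcross X Y) Z\<close> totally
  symmetric.\<close>

lemma jin_jcross_assoc: "jin (jcross X Y) Z = jin X (jcross Y Z)"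
proof -
  have "jin (jprod X Y) Z = jin X (jprod Y Z)"
    by (simp add: jin_def jtr_assoc)
  then show ?thesis
    by (simp add: jcross_def jin_bilinear jin_minus jin_one jin_commute[of X] algebra_simps)
qed

lemma jcross_jmk:
  "jcross (jmk a b c x y z) (jmk a' b' c' x' y' z') = (1/2) *\<^sub>R
     jmk (b * c' + c * b' - 2 * (x \<bullet> x')) (c * a' + a * c' - 2 * (y \<bullet> y')) (a * b' + b * a' - 2 * (z \<bullet> z'))
       (oconj (omult y z' + omult y' z) - a *\<^sub>R x' - a' *\<^sub>R x)
       (oconj (omult z x' + omult z' x) - b *\<^sub>R y' - b' *\<^sub>R y)
       (oconj (omult x y' + omult x' y) - c *\<^sub>R z' - c' *\<^sub>R z)"
  by (simp add: jcross_def jprod_jmk jmk_linear jmk_const algebra_simps)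

lemma omult_conj: "omult x (oconj x) = oreal (x \<bullet> x)" "omult (oconj x) x = oreal (x \<bullet> x)"
  by (simp_all add: omult_def qmult_def qconj_def oconj_def oreal_def inner_prod_def
      inner_complex_def prod_eq_iff complex_eq_iff algebra_simps)

lemma add_oconj: "x + oconj x = oreal (2 * ore x)"
  by (simp add: qconj_def oconj_def oreal_def ore_def prod_eq_iff complex_eq_iff)

lemma inner_oreal: "x \<bullet> oreal r = r * ore x" "oreal r \<bullet> x = r * ore x"
  by (simp_all add: oreal_def ore_def inner_prod_def inner_complex_def)

lemma omult_oreal: "omult (oreal r) x = r *\<^sub>R x" "omult x (oreal r) = r *\<^sub>R x"
  by (simp_all add: omult_def qmult_def qconj_def oreal_def prod_eq_iff complex_eq_iff)

lemma oreal_eq_0_iff [simp]: "oreal r = 0 \<longleftrightarrow> r = 0"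
  by (simp add: oreal_def prod_eq_iff)

lemma ore_0 [simp]: "ore 0 = 0"
  by (simp add: ore_def)

section \<open>Automorphisms and the Freudenthal product\<close>

text \<open>Such a functional kills associators, which span the trace zero matrices; its value at
  the unit then fixes it.\<close>

lemma jtr_jprod_functional:
  assumes T: "linear T" and assoc: "\<And>X Y Z. T (jprod (jprod X Y) Z) = T (jprod X (jprod Y Z))"
    and one: "T jone = 3"
  shows "T X = jtr X"
proof -
  note scaleR = linear_scale[OF T] and add = linear_add[OF T]
  let ?E1 = "jmk 1 0 0 0 0 0" and ?E2 = "jmk 0 1 0 0 0 0" and ?E3 = "jmk 0 0 1 0 0 0"
  \<comment> \<open>Off-diagonal matrices and differences of diagonal idempotents are multiples of associators.\<close>
  have F: "T (jmk 0 0 0 x 0 0) = 0" "T (jmk 0 0 0 0 x 0) = 0" "T (jmk 0 0 0 0 0 x) = 0" for x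
    using assoc[of ?E2 ?E2 "jmk 0 0 0 x 0 0"] assoc[of ?E3 ?E3 "jmk 0 0 0 0 x 0"] assoc[of ?E1 ?E1 "jmk 0 0 0 0 0 x"]
      scaleR[of "1/2" "jmk 0 0 0 x 0 0"] scaleR[of "1/4" "jmk 0 0 0 x 0 0"]
      scaleR[of "1/2" "jmk 0 0 0 0 x 0"] scaleR[of "1/4" "jmk 0 0 0 0 x 0"]
      scaleR[of "1/2" "jmk 0 0 0 0 0 x"] scaleR[of "1/4" "jmk 0 0 0 0 0 x"]
    by (simp_all add: jprod_jmk jmk_linear omult_linear)
  have i: "oreal 1 \<bullet> oreal 1 = 1" by (simp add: inner_oreal oreal_def ore_def)
  \<comment> \<open>For the off-diagonal matrix \<open>F\<close> used here, \<open>(F F) ?E1\<close>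
    is \<open>?E1\<close>, while \<open>F (F ?E1)\<close> is half of
    \<open>?E1 + ?E2\<close>.\<close>
  have E1: "T ?E1 = T ?E2"
    using assoc[of "jmk 0 0 0 0 0 (oreal 1)" "jmk 0 0 0 0 0 (oreal 1)" ?E1]
      scaleR[of "1/2" ?E1] scaleR[of "1/2" ?E2] add[of "jmk (1/2) 0 0 0 0 0" "jmk 0 (1/2) 0 0 0 0"]
    by (simp add: jprod_jmk jmk_linear omult_linear i)
  have E2: "T ?E2 = T ?E3"
    using assoc[of "jmk 0 0 0 (oreal 1) 0 0" "jmk 0 0 0 (oreal 1) 0 0" ?E2]
      scaleR[of "1/2" ?E2] scaleR[of "1/2" ?E3] add[of "jmk 0 (1/2) 0 0 0 0" "jmk 0 0 (1/2) 0 0 0"]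
    by (simp add: jprod_jmk jmk_linear omult_linear i)
  have j: "jone = ?E1 + ?E2 + ?E3" by (simp add: jmk_linear jmk_const)
  have "T jone = T ?E1 + T ?E2 + T ?E3" unfolding j linear_add[OF T] ..
  then have "T ?E1 + T ?E2 + T ?E3 = 3" using one by simp
  with E1 E2 have E: "T ?E1 = 1" "T ?E2 = 1" "T ?E3 = 1" by auto
  obtain a b c x y z where X: "X = jmk a b c x y z" by (cases X)
  have "X = a *\<^sub>R ?E1 + b *\<^sub>R ?E2 + c *\<^sub>R ?E3 + jmk 0 0 0 x 0 0 + jmk 0 0 0 0 y 0 + jmk 0 0 0 0 0 z"
    by (simp add: X jmk_linear)
  then have "T X = a + b + c"
    by (simp only: linear_add[OF T] linear_scale[OF T] E F) simp
  then show ?thesis by (simp add: X)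
qed

lemma F4_jone: assumes "k \<in> F4" shows "k jone = jone"
proof -
  have "bij k" and k: "\<And>X Y. k (jprod X Y) = jprod (k X) (k Y)"
    using assms by (auto simp: F4_def)
  then obtain U where "k U = jone" by (metis bij_pointE)
  with k[of U jone] show ?thesis by (simp add: jprod_one)
qed

text \<open>The pullback of the trace along \<open>k\<close> is again associative, with value 3 at
  \<open>jone\<close>.\<close>

lemma F4_jtr: assumes "k \<in> F4" shows "jtr (k X) = jtr X"
proof -
  have k: "linear k" "\<And>X Y. k (jprod X Y) = jprod (k X) (k Y)"
    using assms by (auto simp: F4_def)
  have "linear (\<lambda>X. jtr (k X))"
    using k(1) by (intro linearI) (simp_all add: linear_add linear_scale)
  then show ?thesis
    by (rule jtr_jprod_functional)
      (simp_all only: k jtr_assoc F4_jone[OF assms], simp add: jmk_const)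
qed

lemma F4_jin: "k \<in> F4 \<Longrightarrow> jin (k X) (k Y) = jin X Y"
  using F4_jtr[of k "jprod X Y"] by (simp add: jin_def F4_def)

lemma F4_jcross: "k \<in> F4 \<Longrightarrow> k (jcross X Y) = jcross (k X) (k Y)"
  using F4_jone[of k] by (simp add: jcross_def F4_jtr F4_jin)
    (simp add: F4_def linear_add linear_diff linear_scale)

text \<open>The equation holds for the unit matrix and mentions only cross product and form, so it
  singles out the unit in terms of these.\<close>

lemma jcross_one_unique:
  assumes "\<And>X. 2 *\<^sub>R jcross A X = jin A X *\<^sub>R A - X"
  shows "A = jone"
proof -
  obtain a b c x y z where A: "A = jmk a b c x y z" by (cases A)
  note s = A jcross_jmk jmk_linear omult_linear inner_oreal
  have 1: "a * a = 1" "y = 0" "z = 0"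
    using assms[of "jmk 1 0 0 0 0 0"] by (auto simp: s)
  have 2: "b * b = 1" "x = 0"
    using assms[of "jmk 0 1 0 0 0 0"] by (auto simp: s)
  \<comment> \<open>The diagonal idempotents leave the signs of \<open>a\<close> and
    \<open>b\<close> open; off-diagonal matrices settle them and give \<open>c\<close>.\<close>
  have "a *\<^sub>R oreal 1 = oreal 1" "b *\<^sub>R oreal 1 = oreal 1" "c *\<^sub>R oreal 1 = oreal 1"
    using assms[of "jmk 0 0 0 (oreal 1) 0 0"] assms[of "jmk 0 0 0 0 (oreal 1) 0"] assms[of "jmk 0 0 0 0 0 (oreal 1)"]
    by (auto simp: s 1 2)
  then have "a = 1" "b = 1" "c = 1" by (simp_all add: oreal_def scaleR_conv_of_real)
  with 1 2 show ?thesis by (simp add: A jmk_const)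
qed

text \<open>\<open>k jone\<close> inherits the equation of \<open>jcross_one_unique\<close>, so it
  is \<open>jone\<close>; the trace is the form against the unit, and \<open>jprod_jcross\<close>
  yields the product.\<close>

lemma F4I_jcross:
  assumes k: "linear k" "bij k" and cross: "\<And>X Y. k (jcross X Y) = jcross (k X) (k Y)"
    and inn: "\<And>X Y. jin (k X) (k Y) = jin X Y"
  shows "k \<in> F4"
proof -
  interpret linear k by fact
  have one: "k jone = jone"
  proof (rule jcross_one_unique)
    fix X
    obtain Y where Y: "X = k Y" using k(2) by (metis bij_pointE)
    have "2 *\<^sub>R jcross jone Y = jin jone Y *\<^sub>R jone - Y"
      by (cases Y) (simp add: jcross_jmk jmk_const jmk_linear omult_linear)
    then have "k (2 *\<^sub>R jcross jone Y) = k (jin jone Y *\<^sub>R jone - Y)" by simp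
    then show "2 *\<^sub>R jcross (k jone) X = jin (k jone) X *\<^sub>R k jone - X"
      by (simp add: scaleR diff cross inn Y)
  qed
  have tr: "jtr (k X) = jtr X" for X
    using inn[of X jone] by (simp add: one jin_one)
  show ?thesis
    using k by (simp add: F4_def jprod_jcross scaleR add diff cross inn one tr)
qed

text \<open>Differentiating \<open>jcross p p = 0\<close> along its cone of solutions gives
  \<open>jcross p X = 0\<close> for tangent vectors \<open>X\<close>; each case exhibits one outside
  the line of \<open>p\<close>.\<close>

lemma jcross_kernel:
  assumes "jcross p p = 0" "p \<noteq> 0"
  obtains X where "jcross p X = 0" "\<And>r. X \<noteq> r *\<^sub>R p"
proof -
  obtain a b c x y z where p: "p = jmk a b c x y z" by (cases p)
  have d: "2 *\<^sub>R u - v = v \<Longrightarrow> u = v" for u v :: octonion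
  proof -
    assume "2 *\<^sub>R u - v = v"
    then have "2 *\<^sub>R u = 2 *\<^sub>R v" by (simp add: scaleR_2 diff_eq_eq)
    then show "u = v" by simp
  qed
  have e: "b * c = x \<bullet> x" "c * a = y \<bullet> y" "a * b = z \<bullet> z"
    "oconj (omult y z) = a *\<^sub>R x" "oconj (omult z x) = b *\<^sub>R y" "oconj (omult x y) = c *\<^sub>R z"
    using assms(1) d[of "oconj (omult y z)" "a *\<^sub>R x"] d[of "oconj (omult z x)" "b *\<^sub>R y"]
      d[of "oconj (omult x y)" "c *\<^sub>R z"]
    by (simp_all add: p jcross_jmk jmk_const jmk_linear mult.commute flip: scaleR_2)
  note s = p jcross_jmk jmk_linear jmk_const omult_linear inner_oreal omult_oreal omult_conj
      oconj_omult oreal_linear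
  consider "a \<noteq> 0" | "a = 0" "b \<noteq> 0" | "a = 0" "b = 0" by blast
  then show thesis
  proof cases
    case 1
    \<comment> \<open>Here \<open>p\<close> is determined by its first row \<open>(a, z, y*)\<close>, and \<open>?X\<close> is \<open>a\<close> times the derivative
      of \<open>p\<close> with respect to \<open>z\<close> in the direction 1.\<close>
    let ?X = "jmk 0 (2 * ore z) 0 (oconj y) 0 (oreal a)"
    have "a * (x \<bullet> oconj y) = omult y z \<bullet> y"
      using arg_cong[OF e(4), of "\<lambda>u. u \<bullet> oconj y"] by (simp add: inner_oconj)
    also have "\<dots> = ore z * (y \<bullet> y)"
      by (simp add: omult_def qmult_def qconj_def ore_def inner_prod_def inner_complex_def algebra_simps)
    also have "\<dots> = a * (c * ore z)"
      by (simp flip: e(2))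
    finally have "x \<bullet> oconj y = c * ore z" using 1 by simp
    moreover have "omult z (oconj y) + a *\<^sub>R x = (2 * ore z) *\<^sub>R oconj y"
      by (simp add: oconj_omult omult_oreal add_oconj flip: e(4) omult_linear(1))
    ultimately have "jcross p ?X = 0"
      using e(2) by (simp add: s)
    then show thesis
      by (rule that) (use 1 in \<open>auto simp: p jmk_linear\<close>)
  next
    case 2
    then have "y = 0" "z = 0" using e by auto
    \<comment> \<open>Now the second row determines \<open>p\<close>; the witness is
      \<open>b\<close> times the derivative with respect to \<open>z\<close> in the direction 1, at
      \<open>z = 0\<close>.\<close>
    show thesis
      by (rule that[of "jmk 0 0 0 0 (oconj x) (oreal b)"])
        (use 2 e \<open>y = 0\<close> \<open>z = 0\<close> in \<open>auto simp: s mult.commute\<close>)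
  next
    case 3
    then have "x = 0" "y = 0" "z = 0" using e by auto
    \<comment> \<open>Only \<open>c\<close> survives, and the direction of \<open>x\<close> is
      tangent there.\<close>
    show thesis
      by (rule that[of "jmk 0 0 0 (oreal 1) 0 0"])
        (use 3 \<open>x = 0\<close> \<open>y = 0\<close> \<open>z = 0\<close> in \<open>auto simp: s\<close>)
  qed
qed

section \<open>The complexification\<close>

lemma jtr_minus: "jtr (X - Y) = jtr X - jtr Y"
  using jtr_linear(1)[of "X - Y" Y] by simp

lemma jcross_minus: "jcross (X - Y) Z = jcross X Z - jcross Y Z" "jcross Z (X - Y) = jcross Z X - jcross Z Y"
  using jcross_bilinear(1)[of "X - Y" Y Z] jcross_bilinear(2)[of Z "X - Y" Y] by simp_all

lemma jin_0 [simp]: "jin 0 X = 0" "jin X 0 = 0"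
  using jin_bilinear(3)[of 0 X X] jin_bilinear(4)[of X 0 X] by simp_all

lemma jin_uminus: "jin (- X) Y = - jin X Y" "jin X (- Y) = - jin X Y"
  using jin_minus(1)[of 0 X Y] jin_minus(2)[of X 0 Y] by simp_all

lemma jcross_0 [simp]: "jcross 0 X = 0" "jcross X 0 = 0"
  using jcross_bilinear(3)[of 0 X X] jcross_bilinear(4)[of X 0 X] by simp_all

lemma ccross_eq: "ccross X Y =
  (jcross (fst X) (fst Y) - jcross (snd X) (snd Y), jcross (fst X) (snd Y) + jcross (snd X) (fst Y))"
  by (simp add: ccross_def cmul_def cprod_def ctr_def cinner_def cone_def jcross_def jin_def prod_eq_iff
      jtr_minus algebra_simps)

lemma cinner_eq: "cinner X Y =
  Complex (jin (fst X) (fst Y) - jin (snd X) (snd Y)) (jin (fst X) (snd Y) + jin (snd X) (fst Y))"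
  by (simp add: cinner_def ctr_def cprod_def jin_def jtr_minus)

lemma cmul_simps [simp]:
  "cmul a 0 = 0" "cmul 0 X = 0" "cmul 1 X = X" "cmul a (cmul b X) = cmul (a * b) X" "cmul a (- X) = cmul (- a) X"
  by (auto simp: cmul_def prod_eq_iff algebra_simps)

lemma cmul_linear:
  "cmul a (X + Y) = cmul a X + cmul a Y" "cmul a (X - Y) = cmul a X - cmul a Y"
  "cmul (a + b) X = cmul a X + cmul b X" "cmul (a - b) X = cmul a X - cmul b X" "cmul (- a) X = - cmul a X"
  by (auto simp: cmul_def prod_eq_iff algebra_simps)

lemma cmul_eq_0_iff: "cmul a X = 0 \<longleftrightarrow> a = 0 \<or> X = 0"
  by (rule vector_space.scale_eq_0_iff[OF vector_space_cmul])

lemma ccross_bilinear: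
  "ccross (X + Y) Z = ccross X Z + ccross Y Z" "ccross Z (X + Y) = ccross Z X + ccross Z Y"
  "ccross (cmul a X) Z = cmul a (ccross X Z)" "ccross Z (cmul a X) = cmul a (ccross Z X)"
  by (simp_all add: ccross_eq cmul_def jcross_bilinear jcross_minus algebra_simps)

lemma cinner_bilinear:
  "cinner (X + Y) Z = cinner X Z + cinner Y Z" "cinner Z (X + Y) = cinner Z X + cinner Z Y"
  "cinner (cmul a X) Z = a * cinner X Z" "cinner Z (cmul a X) = a * cinner Z X"
  by (simp_all add: cinner_eq cmul_def jin_bilinear jin_minus complex_eq_iff algebra_simps)

lemma cinner_diff:
  "cinner (X - Y) Z = cinner X Z - cinner Y Z" "cinner Z (X - Y) = cinner Z X - cinner Z Y"
  by (simp_all add: cinner_eq jin_minus complex_eq_iff)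

lemma ccross_0 [simp]: "ccross 0 X = 0" "ccross X 0 = 0"
  using ccross_bilinear(3)[of 0 X X] ccross_bilinear(4)[of X 0 X] by simp_all

lemma cinner_0 [simp]: "cinner 0 X = 0" "cinner X 0 = 0"
  using cinner_bilinear(3)[of 0 X X] cinner_bilinear(4)[of X 0 X] by simp_all

lemma cinner_commute: "cinner X Y = cinner Y X"
  by (simp add: cinner_eq jin_commute)

lemma ccross_commute: "ccross X Y = ccross Y X"
  by (simp add: ccross_eq jcross_commute)

lemma cinner_ccross_assoc: "cinner (ccross X Y) Z = cinner X (ccross Y Z)"
  by (simp add: ccross_eq cinner_eq jin_minus jin_bilinear jin_jcross_assoc)

text \<open>Real test vectors separate the real and imaginary parts of \<open>Y - Z\<close>, and the
  real form is definite.\<close>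

lemma cinner_nondegenerate:
  assumes "\<And>X. cinner X Y = cinner X Z"
  shows "Y = Z"
proof -
  have "jin a (fst (Y - Z)) = 0 \<and> jin a (snd (Y - Z)) = 0" for a
    using assms[of "(a, 0)"] by (simp add: cinner_eq jin_minus)
  then have "fst (Y - Z) = 0" "snd (Y - Z) = 0"
    by (metis jin_eq_0_iff)+
  then show ?thesis by (simp add: prod_eq_iff)
qed

section \<open>Transposes and an explicit formula for \<open>pcross\<close>\<close>

lemma ctransp_eqI:
  assumes "\<And>X Y. cinner (\<phi> X) Y = cinner X (\<psi> Y)"
  shows "ctransp \<phi> = \<psi>"
  unfolding ctransp_def
proof (rule the_equality)
  fix \<psi>' assume "\<forall>X Y. cinner (\<phi> X) Y = cinner X (\<psi>' Y)"
  then show "\<psi>' = \<psi>"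
    using assms by (intro ext cinner_nondegenerate) metis
qed (simp add: assms)

text \<open>Symmetry of \<open>cinner (ccross X Y) Z\<close> moves both cross products to the other
  side in reversed order, so transposition swaps \<open>X\<close> and \<open>W\<close>.\<close>

lemma cinner_cvee: "cinner (cvee X W U) V = cinner U (cvee W X V)"
proof -
  have "cinner (ccross W (ccross X U)) V = cinner U (ccross X (ccross W V))"
    by (metis cinner_ccross_assoc ccross_commute)
  then show ?thesis
    by (simp add: cvee_def cinner_bilinear cinner_diff cinner_commute)
qed

lemma ctransp_cvee:
  "ctransp (\<lambda>U. cmul a (cvee X W U + cvee Z Y U)) = (\<lambda>U. cmul a (cvee W X U + cvee Y Z U))"
  by (rule ctransp_eqI) (simp add: cinner_bilinear cinner_cvee)

text \<open>With the definite description in \<open>ctransp\<close> evaluated, products can be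
  computed on explicit vectors.\<close>

lemma pcross_eq:
  "pcross (X, Y, \<xi>, \<eta>) (Z, W, \<zeta>, \<omega>) (U, V, \<mu>, \<kappa>) =
   (let A = cmul (- (1/4)) (cmul 2 (ccross Y W) - cmul \<xi> Z - cmul \<zeta> X);
        B = cmul (1/4) (cmul 2 (ccross X Z) - cmul \<eta> W - cmul \<omega> Y);
        \<nu> = 1/8 * (cinner X W + cinner Z Y - 3 * (\<xi> * \<omega> + \<zeta> * \<eta>))
    in (cmul (- (1/2)) (cvee X W U + cvee Z Y U) - cmul (1/3 * \<nu>) U + cmul 2 (ccross B V) + cmul \<kappa> A,
        cmul 2 (ccross A U) - cmul (- (1/2)) (cvee W X V + cvee Y Z V) + cmul (1/3 * \<nu>) V + cmul \<mu> B,
        cinner A V + \<nu> * \<mu>, cinner B U - \<nu> * \<kappa>))"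
  by (simp add: Let_def ctransp_cvee)

lemma cvee_0 [simp]: "cvee 0 X U = 0" "cvee X 0 U = 0" "cvee X Y 0 = 0"
  by (simp_all add: cvee_def)

lemma cherm_eq: "cherm X Y =
  Complex (jin (fst X) (fst Y) + jin (snd X) (snd Y)) (jin (fst X) (snd Y) - jin (snd X) (fst Y))"
  by (simp add: cherm_def cxconj_def cinner_eq jin_uminus)

lemma cherm_0 [simp]: "cherm 0 X = 0" "cherm X 0 = 0"
  by (simp_all add: cherm_eq complex_eq_iff)

section \<open>The group and its subgroup\<close>

lemma conjugate_eq_iff:
  assumes "bij f"
  shows "f \<circ> g \<circ> inv_into UNIV f = h \<longleftrightarrow> (\<forall>x. f (g x) = h (f x))" (is "?L = ?R")
proof
  assume ?L
  then show ?R
    using assms by (auto simp: bij_is_inj simp del: split_paired_All)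
next
  assume ?R
  then have "f (g (inv_into UNIV f y)) = h y" for y
    using assms by (simp add: bij_is_surj surj_f_inv_f del: split_paired_All)
  then show ?L
    by (simp add: fun_eq_iff del: split_paired_All)
qed

lemma E7_iff:
  "\<alpha> \<in> E7 \<longleftrightarrow> bij \<alpha> \<and> (\<forall>P Q. \<alpha> (P + Q) = \<alpha> P + \<alpha> Q) \<and> (\<forall>c P. \<alpha> (pmul c P) = pmul c (\<alpha> P))
     \<and> (\<forall>P Q R. pcross (\<alpha> P) (\<alpha> Q) (\<alpha> R) = \<alpha> (pcross P Q R))
     \<and> (\<forall>P Q. pherm (\<alpha> P) (\<alpha> Q) = pherm P Q)"
proof -
  have "(\<forall>R. \<alpha> (pcross P Q R) = pcross (\<alpha> P) (\<alpha> Q) (\<alpha> R)) \<longleftrightarrow>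
      (\<forall>R. pcross (\<alpha> P) (\<alpha> Q) (\<alpha> R) = \<alpha> (pcross P Q R))" for P Q
    by metis
  then show ?thesis
    by (simp add: E7_def Vector_Spaces.linear_iff vector_space_pmul conjugate_eq_iff
        del: split_paired_All cong: conj_cong) blast
qed

text \<open>\<open>iota\<close> squares to \<open>-1\<close>, as does \<open>lam\<close>, so the
  negative is the inverse.\<close>

lemma bij_iota: "bij iota"
  by (rule o_bij[of "\<lambda>P. - iota P"]) (auto simp: fun_eq_iff cmul_linear)

lemma bij_lam: "bij lam"
  by (rule o_bij[of "\<lambda>P. - lam P"]) (auto simp: fun_eq_iff)

lemma E7_fix_iff:
  assumes "bij \<sigma>"
  shows "\<alpha> \<in> E7_fix \<sigma> \<longleftrightarrow> \<alpha> \<in> E7 \<and> (\<forall>P. \<sigma> (\<alpha> P) = \<alpha> (\<sigma> P))"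
  using assms by (simp add: E7_fix_def conjugate_eq_iff del: split_paired_All)

abbreviation (input) "E7_fix2 \<equiv> E7_fix iota \<inter> E7_fix lam"

lemma E7_fix2_comp: "\<alpha> \<in> E7_fix2 \<Longrightarrow> \<beta> \<in> E7_fix2 \<Longrightarrow> \<alpha> \<circ> \<beta> \<in> E7_fix2"
  by (simp add: E7_fix_iff bij_iota bij_lam E7_iff bij_comp del: split_paired_All)

section \<open>The elements coming from the sign and from \<open>F4\<close>\<close>

lemma uminus_linear:
  "ccross (- X) Y = - ccross X Y" "ccross X (- Y) = - ccross X Y"
  "cinner (- X) Y = - cinner X Y" "cinner X (- Y) = - cinner X Y"
  using ccross_bilinear(3)[of "-1" X Y] ccross_bilinear(4)[of X "-1" Y]
    cinner_bilinear(3)[of "-1" X Y] cinner_bilinear(4)[of X "-1" Y] by (simp_all add: cmul_linear)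

lemma uminus_in_E7_fix2: "uminus \<in> E7_fix2"
proof -
  have "pcross (- P) (- Q) (- R) = - pcross P Q R" for P Q R
    by (cases P; cases Q; cases R)
      (simp add: pcross_eq Let_def uminus_linear cvee_def cmul_linear del: pcross.simps;
       simp add: cmul_linear algebra_simps)
  moreover have "pherm (- P) (- Q) = pherm P Q" for P Q
    by (cases P; cases Q) (simp add: cherm_eq jin_uminus)
  moreover have "- (pmul c P) = pmul c (- P)" for c P
    by (cases P) (simp add: cmul_linear)
  moreover have "- iota P = iota (- P)" "- lam P = lam (- P)" for P
    by (cases P; simp add: cmul_linear)+
  ultimately show ?thesis
    by (simp add: E7_fix_iff bij_iota bij_lam E7_iff bij_uminus)
qed

text \<open>For linear \<open>k\<close>, \<open>map_prod k k\<close> is its complexification; this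
  embeds \<open>F4\<close> into \<open>E7\<close>.\<close>

fun flift :: "(jordan \<Rightarrow> jordan) \<Rightarrow> freud \<Rightarrow> freud" where
  "flift k (X, Y, \<xi>, \<eta>) = (map_prod k k X, map_prod k k Y, \<xi>, \<eta>)"

lemma flift_comp: "flift (j \<circ> k) = flift j \<circ> flift k"
  by (auto simp: fun_eq_iff)

text \<open>The products and forms involved are all assembled from \<open>jcross\<close> and
  \<open>jin\<close>, which \<open>k\<close> preserves.\<close>

lemma flift_in_E7_fix2:
  assumes k: "k \<in> F4"
  shows "flift k \<in> E7_fix2"
proof -
  have lin: "linear k" and "bij k" using k by (auto simp: F4_def)
  let ?K = "map_prod k k"
  have K: "?K (X + Y) = ?K X + ?K Y" "?K (X - Y) = ?K X - ?K Y" "?K (- X) = - ?K X"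
    "?K (cmul c X) = cmul c (?K X)" "?K (ccross X Y) = ccross (?K X) (?K Y)"
    "cinner (?K X) (?K Y) = cinner X Y" "cherm (?K X) (?K Y) = cherm X Y" for c X Y
    by (cases X; cases Y; simp add: cmul_def ccross_eq cinner_eq cherm_eq F4_jcross[OF k] F4_jin[OF k]
        linear_add[OF lin] linear_diff[OF lin] linear_neg[OF lin] linear_scale[OF lin])+
  \<comment> \<open>Once \<open>K(5)\<close> has pushed \<open>?K\<close> into a cross product,
    \<open>K(6)\<close> no longer matches; this covers that case.\<close>
  have in3: "cinner (ccross (?K X) (?K Y)) (?K Z) = cinner (ccross X Y) Z" for X Y Z
    using K(6)[of "ccross X Y" Z] by (simp only: K(5))
  have vee: "?K (cvee X W U) = cvee (?K X) (?K W) (?K U)" for X W U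
    by (simp add: cvee_def K)
  have "bij (flift k)"
    using \<open>bij k\<close>
    by (intro o_bij[of "flift (inv_into UNIV k)"]) (auto simp: fun_eq_iff bij_is_inj surj_f_inv_f bij_is_surj)
  moreover have "flift k (P + Q) = flift k P + flift k Q" "pherm (flift k P) (flift k Q) = pherm P Q" for P Q
    by (cases P; cases Q; simp add: K)+
  moreover have "pcross (flift k P) (flift k Q) (flift k R) = flift k (pcross P Q R)" for P Q R
    by (cases P; cases Q; cases R) (simp add: pcross_eq Let_def K vee in3 cinner_bilinear cinner_diff del: pcross.simps)
  moreover have "flift k (pmul c P) = pmul c (flift k P)" "flift k (iota P) = iota (flift k P)"
    "flift k (lam P) = lam (flift k P)" for c P
    by (cases P; simp add: K)+
  ultimately show ?thesis
    by (simp add: E7_fix_iff bij_iota bij_lam E7_iff)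
qed

section \<open>Elements commuting with both maps\<close>

lemma zero_freud: "(0 :: freud) = (0, 0, 0, 0)"
  by (simp add: prod_eq_iff)

lemma iota_eigenvector: "iota P = pmul (- \<i>) P \<Longrightarrow> \<exists>X \<xi>. P = (X, 0, \<xi>, 0)"
proof (cases P)
  case (fields X Y \<xi> \<eta>)
  assume "iota P = pmul (- \<i>) P"
  then have Y: "cmul \<i> Y = cmul (- \<i>) Y" and "\<eta> = 0"
    by (simp_all add: fields)
  have "cmul (2 * \<i>) Y = 0"
    using cmul_linear(4)[of \<i> "- \<i>" Y] by (simp add: Y)
  with \<open>\<eta> = 0\<close> show ?thesis by (simp add: fields cmul_eq_0_iff)
qed

lemma cinner_cherm_1_real:
  assumes "cinner X X = 1" "cherm X X = 1"
  shows "snd X = 0"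
proof -
  have "jin (fst X) (fst X) - jin (snd X) (snd X) = 1" "jin (fst X) (fst X) + jin (snd X) (snd X) = 1"
    using assms by (simp_all add: cinner_eq cherm_eq complex_eq_iff)
  then have "jin (snd X) (snd X) = 0" by linarith
  then show ?thesis by (simp add: jin_eq_0_iff)
qed

section \<open>An element of the intersection in block form\<close>

locale E7_fixed =
  fixes \<alpha> :: "freud \<Rightarrow> freud"
  assumes fixed: "\<alpha> \<in> E7_fix2"
begin

lemma
  shows bij: "bij \<alpha>" and add: "\<alpha> (P + Q) = \<alpha> P + \<alpha> Q" and scale: "\<alpha> (pmul c P) = pmul c (\<alpha> P)"
    and cross: "pcross (\<alpha> P) (\<alpha> Q) (\<alpha> R) = \<alpha> (pcross P Q R)"
    and herm: "pherm (\<alpha> P) (\<alpha> Q) = pherm P Q"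
    and iota: "iota (\<alpha> P) = \<alpha> (iota P)" and lam: "lam (\<alpha> P) = \<alpha> (lam P)"
  using fixed unfolding Int_iff E7_fix_iff[OF bij_iota] E7_fix_iff[OF bij_lam] E7_iff by blast+

lemma zero: "\<alpha> 0 = 0"
  using add[of 0 0] by simp

lemma minus: "\<alpha> (- P) = - \<alpha> P"
  using add[of P "- P"] by (simp add: zero minus_unique)

text \<open>The blocks of \<alpha> on the eigenspace of \<open>iota\<close> for
  \<open>- \<i>\<close>; \<open>p\<close> and \<open>c\<close> describe the image of
  \<open>(0, 0, 1, 0)\<close>.\<close>

definition f where "f X = fst (\<alpha> (X, 0, 0, 0))"
definition g where "g X = fst (snd (snd (\<alpha> (X, 0, 0, 0))))"
definition p where "p = fst (\<alpha> (0, 0, 1, 0))"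
definition c where "c = fst (snd (snd (\<alpha> (0, 0, 1, 0))))"

lemma negative_part: "\<alpha> (X, 0, \<xi>, 0) = (f X + cmul \<xi> p, 0, g X + \<xi> * c, 0)"
proof -
  have form: "\<exists>Y \<eta>. \<alpha> (X, 0, \<xi>, 0) = (Y, 0, \<eta>, 0)" for X \<xi>
  proof (rule iota_eigenvector)
    have "iota (X, 0, \<xi>, 0) = pmul (- \<i>) (X, 0, \<xi>, 0)" by simp
    then show "iota (\<alpha> (X, 0, \<xi>, 0)) = pmul (- \<i>) (\<alpha> (X, 0, \<xi>, 0))"
      by (simp only: iota scale)
  qed
  have 1: "\<alpha> (X, 0, 0, 0) = (f X, 0, g X, 0)"
    using form[of X 0] by (auto simp: f_def g_def)
  have 2: "\<alpha> (0, 0, 1, 0) = (p, 0, c, 0)"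
    using form[of 0 1] by (auto simp: p_def c_def)
  have "(X, 0, \<xi>, 0) = (X, 0, 0, 0) + pmul \<xi> (0, 0, 1, 0)" by simp
  then show ?thesis by (simp only: add scale 1 2) simp
qed

text \<open>\<open>lam\<close> interchanges the eigenspaces, so commuting with it forces the same
  blocks here.\<close>

lemma positive_part: "\<alpha> (0, Y, 0, \<eta>) = (0, f Y + cmul \<eta> p, 0, g Y + \<eta> * c)"
proof -
  have "(0, Y, 0, \<eta>) = - lam (Y, 0, \<eta>, 0)" by simp
  then show ?thesis by (simp only: minus lam[symmetric] negative_part) simp
qed

lemma f_add: "f (X + Y) = f X + f Y"
  using add[of "(X, 0, 0, 0)" "(Y, 0, 0, 0)"] by (simp add: f_def)

lemma f_cmul: "f (cmul r X) = cmul r (f X)"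
  using scale[of r "(X, 0, 0, 0)"] by (simp add: negative_part)

lemma f_0: "f 0 = 0" and g_0: "g 0 = 0"
  using zero by (simp_all add: f_def g_def zero_freud)

lemma p_square: "ccross p p = 0" and p_c: "c = 0 \<or> p = 0"
proof -
  have a: "pcross (0, 0, 1, 0) (0, 0, 1, 0) R = 0" for R
    by (cases R) (simp add: pcross_eq Let_def zero_freud del: pcross.simps)
  have "pcross (p, 0, c, 0) (p, 0, c, 0) R = 0" for R
  proof -
    obtain R' where "R = \<alpha> R'" using bij by (metis bij_pointE)
    then show ?thesis
      using cross[of "(0, 0, 1, 0)" "(0, 0, 1, 0)" R'] by (simp add: a negative_part f_0 g_0 zero del: pcross.simps)
  qed
  note r = this
  \<comment> \<open>In this square \<open>A\<close> is half of \<open>cmul c p\<close> and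
    \<open>B\<close> is half of \<open>ccross p p\<close>; the argument \<open>(0, 0, 1, 0)\<close>
    reads off \<open>B\<close>, and \<open>(0, 0, 0, 1)\<close> reads off \<open>A\<close>.\<close>
  show "ccross p p = 0"
    using r[of "(0, 0, 1, 0)"] by (simp add: pcross_eq Let_def zero_freud cmul_eq_0_iff del: pcross.simps)
  have "cmul (- (1/4)) (- cmul c p - cmul c p) = cmul (1/4 * c) p + cmul (1/4 * c) p"
    by (simp add: cmul_linear)
  also have "\<dots> = cmul (1/4 * c + 1/4 * c) p"
    by (simp only: cmul_linear(3))
  also have "1/4 * c + 1/4 * c = 1/2 * c" by simp
  finally show "c = 0 \<or> p = 0"
    using r[of "(0, 0, 0, 1)"] by (simp add: pcross_eq Let_def zero_freud cmul_eq_0_iff del: pcross.simps)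
qed

lemma norm_pc: "cherm p p + cnj c * c = 1"
  using herm[of "(0, 0, 1, 0)" "(0, 0, 1, 0)"] by (simp add: negative_part f_0 g_0)

text \<open>\<open>(0, 0, 1, 0)\<close> is an eigenvector of
  \<open>pcross (0, 0, 1, 0) (0, 0, 0, 1)\<close> for \<open>-3/8\<close>, and \<alpha> transports
  this relation. It fixes the scale of \<open>p\<close> or of \<open>c\<close> once the other
  vanishes.\<close>

lemma cross_unit_units:
  "cmul (- (1/2)) (cvee p p p + cvee 0 0 p) - cmul (1/24 * (cinner p p - 3 * c\<^sup>2)) p = cmul (- (3/8)) p"
    "1/8 * (cinner p p - 3 * c\<^sup>2) * c = - (3/8) * c"
  using cross[of "(0, 0, 1, 0)" "(0, 0, 0, 1)" "(0, 0, 1, 0)"]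
  by (simp_all add: negative_part positive_part f_0 g_0 pcross_eq Let_def power2_eq_square del: pcross.simps)

lemma p_0: "p = 0"
proof (rule ccontr)
  assume p: "p \<noteq> 0"
  with p_c have c: "c = 0" by simp
  have "cvee p p p = cmul (2/3 * cinner p p) p"
    by (simp add: cvee_def p_square flip: cmul_linear)
  \<comment> \<open>The coefficient on the left is \<open>- (3/8) * cinner p p\<close>.\<close>
  then have "cmul (- (1/2) * (2/3 * cinner p p) - 1/24 * cinner p p) p = cmul (- (3/8)) p"
    unfolding cmul_linear(4) using cross_unit_units(1) by (simp add: c)
  then have "cmul (- (1/2) * (2/3 * cinner p p) - 1/24 * cinner p p - (- (3/8))) p = 0"
    by (simp only: cmul_linear(4)) simp
  with p have 1: "cinner p p = 1" by (simp add: cmul_eq_0_iff)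
  moreover have "cherm p p = 1" using norm_pc by (simp add: c)
  ultimately have "snd p = 0" by (rule cinner_cherm_1_real)
  then obtain q where q: "p = (q, 0)" by (cases p) auto
  have "jcross q q = 0" "q \<noteq> 0"
    using p p_square by (simp_all add: q ccross_eq prod_eq_iff)
  then obtain X where X: "jcross q X = 0" "\<And>r. X \<noteq> r *\<^sub>R q"
    by (rule jcross_kernel) blast
  obtain P where P: "\<alpha> P = ((X, 0), 0, 0, 0)" using bij by (metis bij_pointE)
  have "iota (\<alpha> P) = pmul (- \<i>) (\<alpha> P)" by (simp add: P)
  then have "\<alpha> (iota P) = \<alpha> (pmul (- \<i>) P)" by (simp only: iota scale)
  then have "iota P = pmul (- \<i>) P" using bij by (simp add: bij_def inj_eq)
  then obtain Z \<zeta> where Z: "P = (Z, 0, \<zeta>, 0)" using iota_eigenvector by blast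
  have "ccross p (X, 0) = 0" by (simp add: q ccross_eq X prod_eq_iff)
  then have "pcross (p, 0, 0, 0) ((X, 0), 0, 0, 0) R = 0" for R
    by (cases R) (simp add: pcross_eq Let_def zero_freud del: pcross.simps)
  then have "\<alpha> (pcross (0, 0, 1, 0) P R) = \<alpha> 0" for R
    by (simp add: cross[symmetric] P negative_part f_0 g_0 c zero del: pcross.simps)
  then have "pcross (0, 0, 1, 0) P R = 0" for R
    using bij by (metis bij_pointE)
  \<comment> \<open>Here \<open>A\<close> is a quarter of \<open>Z\<close>, and the argument
    \<open>(0, 0, 0, 1)\<close> returns \<open>A\<close>.\<close>
  from this[of "(0, 0, 0, 1)"] have "Z = 0"
    by (simp add: pcross_eq Let_def Z zero_freud cmul_eq_0_iff del: pcross.simps)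
  then have "(X, 0) = cmul \<zeta> p"
    using P by (simp add: Z negative_part f_0 g_0)
  then have "X = Re \<zeta> *\<^sub>R q" by (simp add: q cmul_def)
  with X(2) show False by blast
qed

lemma c_sign: "c = 1 \<or> c = - 1"
proof -
  have "c \<noteq> 0" using norm_pc by (auto simp: p_0)
  then have "c\<^sup>2 = 1" using cross_unit_units(2) by (simp add: p_0)
  then show ?thesis by (simp add: power2_eq_1_iff)
qed

text \<open>\<alpha> keeps \<open>(X, 0, 0, 0)\<close> orthogonal to \<open>(0, 0, 1, 0)\<close>,
  whose image is now \<open>(0, 0, c, 0)\<close>.\<close>

lemma g_eq_0: "g X = 0"
  using herm[of "(X, 0, 0, 0)" "(0, 0, 1, 0)"] c_sign
  by (auto simp: negative_part f_0 g_0 p_0)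

lemma diagonal: "\<alpha> (X, Y, \<xi>, \<eta>) = (f X, f Y, \<xi> * c, \<eta> * c)"
proof -
  have "(X, Y, \<xi>, \<eta>) = (X, 0, \<xi>, 0) + (0, Y, 0, \<eta>)" by simp
  then show ?thesis by (simp only: add negative_part positive_part) (simp add: p_0 g_eq_0)
qed

text \<open>\<open>f\<close> respects the Freudenthal product only up to the sign \<open>c\<close>;
  this twist removes it.\<close>

definition h where "h X = cmul c (f X)"

lemma f_h: "f X = cmul c (h X)"
  using c_sign by (auto simp: h_def)

text \<open>In \<open>pcross (0, 0, 1, 0) (X, 0, 0, 0)\<close> only \<open>A\<close> is present, a
  quarter of \<open>X\<close>; acting on the first and second components it displays the cross
  product and the form.\<close>

lemma h_ccross: "h (ccross X Y) = ccross (h X) (h Y)"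
  and h_cinner: "cinner (h X) (h Y) = cinner X Y"
proof -
  have cc: "c * c = 1" using c_sign by auto
  have "cmul (1/2) (f (ccross X Y)) = cmul (1/2 * c) (ccross (f X) (f Y))"
    using cross[of "(0, 0, 1, 0)" "(X, 0, 0, 0)" "(Y, 0, 0, 0)"]
    by (simp add: diagonal f_0 pcross_eq Let_def ccross_bilinear f_cmul del: pcross.simps)
  then have "cmul 2 (cmul (1/2) (f (ccross X Y))) = cmul 2 (cmul (1/2 * c) (ccross (f X) (f Y)))" by simp
  then show "h (ccross X Y) = ccross (h X) (h Y)"
    by (simp add: h_def ccross_bilinear cc mult.assoc[symmetric])
  have "c * cinner (f X) (f Y) = c * cinner X Y"
    using cross[of "(0, 0, 1, 0)" "(X, 0, 0, 0)" "(0, Y, 0, 0)"]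
    by (simp add: diagonal f_0 pcross_eq Let_def cinner_bilinear del: pcross.simps)
  then show "cinner (h X) (h Y) = cinner X Y"
    using c_sign by (auto simp: h_def cinner_bilinear)
qed

lemma h_surj: "\<exists>X. Y = h X"
proof -
  obtain P where P: "\<alpha> P = (cmul c Y, 0, 0, 0)" using bij by (metis bij_pointE)
  obtain X Z \<xi> \<eta> where "P = (X, Z, \<xi>, \<eta>)" by (cases P)
  with P have "f X = cmul c Y" by (simp add: diagonal)
  then have "Y = h X" using c_sign by (auto simp: h_def)
  then show ?thesis ..
qed

lemma h_cmul: "h (cmul r X) = cmul r (h X)"
  by (simp add: h_def f_cmul mult.commute)

lemma h_add: "h (X + Y) = h X + h Y"
  by (simp add: h_def f_add cmul_linear)

text \<open>The Hermitian form is the bilinear one twisted by \<open>cxconj\<close>. As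
  \<open>h\<close> preserves both and is onto, nondegeneracy applies.\<close>

lemma h_cxconj: "h (cxconj X) = cxconj (h X)"
proof (rule cinner_nondegenerate)
  fix Y
  obtain Z where Z: "Y = h Z" using h_surj by blast
  have "cherm (h X) (h Z) = cherm X Z"
    using herm[of "(X, 0, 0, 0)" "(Z, 0, 0, 0)"] c_sign
    by (auto simp: diagonal f_0 h_def cherm_eq jin_uminus cmul_def)
  then have "cinner (cxconj (h X)) (h Z) = cinner (h (cxconj X)) (h Z)"
    by (simp add: cherm_def h_cinner)
  then show "cinner Y (h (cxconj X)) = cinner Y (cxconj (h X))"
    by (simp add: Z cinner_commute)
qed

definition k where "k X = fst (h (X, 0))"

text \<open>Commuting with \<open>cxconj\<close> keeps real elements real; complex linearity gives
  the rest.\<close>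

lemma h_k: "h = map_prod k k"
proof
  fix X :: jordanC
  obtain a b where X: "X = (a, b)" by (cases X)
  have r: "h (a, 0) = (k a, 0)" for a
  proof -
    have "h (a, 0) = cxconj (h (a, 0))" using h_cxconj[of "(a, 0)"] by (simp add: cxconj_def)
    then have "snd (h (a, 0)) = - snd (h (a, 0))" by (metis cxconj_def snd_conv)
    then have "2 *\<^sub>R snd (h (a, 0)) = 0" by (simp add: scaleR_2 eq_neg_iff_add_eq_0)
    then show ?thesis by (simp add: k_def prod_eq_iff)
  qed
  have "(a, b) = (a, 0) + cmul \<i> (b, 0)" by (simp add: cmul_def)
  then have "h (a, b) = h (a, 0) + cmul \<i> (h (b, 0))" by (simp only: h_add h_cmul)
  then show "h X = map_prod k k X" by (simp add: X r cmul_def)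
qed

lemma k_F4: "k \<in> F4"
proof (rule F4I_jcross)
  show "linear k"
  proof (rule linearI)
    show "k (X + Y) = k X + k Y" for X Y
      using h_add[of "(X, 0)" "(Y, 0)"] by (simp add: h_k)
    show "k (r *\<^sub>R X) = r *\<^sub>R k X" for r X
      using h_cmul[of "of_real r" "(X, 0)"] by (simp add: h_k cmul_def)
  qed
  then have k_0: "k 0 = 0" by (rule linear_0)
  show inn: "jin (k X) (k Y) = jin X Y" for X Y
    using h_cinner[of "(X, 0)" "(Y, 0)"] by (simp add: h_k cinner_eq complex_eq_iff k_0)
  show "bij k"
  proof (rule bijI)
    show "surj k" using h_surj by (force simp: h_k surj_def)
    show "inj k"
      unfolding linear_injective_0[OF \<open>linear k\<close>] using inn by (metis jin_eq_0_iff)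
  qed
  show "k (jcross X Y) = jcross (k X) (k Y)" for X Y
    using h_ccross[of "(X, 0)" "(Y, 0)"] by (simp add: h_k ccross_eq k_0)
qed

end

section \<open>Assembling the isomorphism\<close>

lemma E7_fix2_cases:
  assumes "\<alpha> \<in> E7_fix2"
  obtains k where "k \<in> F4" "\<alpha> = flift k \<or> \<alpha> = uminus \<circ> flift k"
proof -
  interpret E7_fixed \<alpha> by unfold_locales fact
  have "\<alpha> P = flift k P" if "c = 1" for P
    using that by (cases P) (simp add: diagonal f_h h_k)
  moreover have "\<alpha> P = - flift k P" if "c = - 1" for P
    using that by (cases P) (simp add: diagonal f_h h_k cmul_linear)
  ultimately have "\<alpha> = flift k \<or> \<alpha> = uminus \<circ> flift k"
    using c_sign by (auto simp: fun_eq_iff)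
  with k_F4 show thesis by (rule that)
qed

text \<open>Allows the map to start from the product side; closure keeps products of preimages in
  \<open>carrier G\<close>, where \<open>h\<close> is injective.\<close>

lemma iso_symI:
  assumes h: "h \<in> iso G H" and closed: "\<And>x y. x \<in> carrier G \<Longrightarrow> y \<in> carrier G \<Longrightarrow> x \<otimes>\<^bsub>G\<^esub> y \<in> carrier G"
  shows "H \<cong> G"
proof -
  let ?g = "inv_into (carrier G) h"
  have bij: "bij_betw h (carrier G) (carrier H)" and hom: "h \<in> hom G H"
    using h by (auto simp: iso_def)
  have g: "?g x \<in> carrier G" "h (?g x) = x" if "x \<in> carrier H" for x
    using that bij by (auto simp: bij_betw_def inv_into_into f_inv_into_f)
  have "?g (x \<otimes>\<^bsub>H\<^esub> y) = ?g x \<otimes>\<^bsub>G\<^esub> ?g y" if "x \<in> carrier H" "y \<in> carrier H" for x y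
  proof -
    have "h (?g x \<otimes>\<^bsub>G\<^esub> ?g y) = x \<otimes>\<^bsub>H\<^esub> y"
      using that g hom by (simp add: hom_mult)
    moreover have "?g (h (?g x \<otimes>\<^bsub>G\<^esub> ?g y)) = ?g x \<otimes>\<^bsub>G\<^esub> ?g y"
      using that g closed bij by (simp add: bij_betw_def inv_into_f_f)
    ultimately show ?thesis by simp
  qed
  then have "?g \<in> iso H G"
    using g bij_betw_inv_into[OF bij] by (auto simp: iso_def hom_def)
  then show ?thesis by (auto simp: is_iso_def)
qed

lemma F4_comp: "j \<in> F4 \<Longrightarrow> k \<in> F4 \<Longrightarrow> j \<circ> k \<in> F4"
  by (auto simp: F4_def linear_compose bij_comp)

lemma Z2_comp: "z \<in> Z2 \<Longrightarrow> w \<in> Z2 \<Longrightarrow> z \<circ> w \<in> Z2"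
  by (auto simp: Z2_def fun_eq_iff)

theorem theorem4p19p3:
  shows "map_group (E7_fix iota \<inter> E7_fix lam) \<cong> map_group F4 \<times>\<times> map_group Z2"
proof (rule iso_symI)
  let ?\<Theta> = "\<lambda>(k, z). z \<circ> flift k"
  have range: "z \<circ> flift k \<in> E7_fix2" if "k \<in> F4" "z \<in> Z2" for k z
    using flift_in_E7_fix2[OF that(1)] E7_fix2_comp[OF uminus_in_E7_fix2, of "flift k"] that(2)
    by (auto simp: Z2_def)
  have hom: "(z \<circ> w) \<circ> flift (j \<circ> k) = (z \<circ> flift j) \<circ> (w \<circ> flift k)"
    if "j \<in> F4" "w \<in> Z2" for j k z w
  proof -
    \<comment> \<open>The sign passes through \<open>flift j\<close>, so the two factors
      commute.\<close>
    have "flift j (- P) = - flift j P" for P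
      using flift_in_E7_fix2[OF that(1)] E7_fixed.minus[of "flift j"] by (simp add: E7_fixed_def)
    then have "flift j \<circ> w = w \<circ> flift j"
      using that(2) by (auto simp: Z2_def fun_eq_iff)
    then show ?thesis by (simp add: flift_comp fun_eq_iff)
  qed
  have "inj_on ?\<Theta> (F4 \<times> Z2)"
  proof (rule inj_onI, clarify)
    fix j z k w
    assume "j \<in> F4" "z \<in> Z2" "k \<in> F4" "w \<in> Z2" and eq: "z \<circ> flift j = w \<circ> flift k"
    \<comment> \<open>\<open>flift\<close> leaves the coordinate \<open>1\<close> alone, so it
      exposes the sign; the first component then compares \<open>j\<close> with
      \<open>k\<close>.\<close>
    have "z ((j X, j 0), (j 0, j 0), 1, 0) = w ((k X, k 0), (k 0, k 0), 1, 0)" for X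
      using fun_cong[OF eq, of "((X, 0), 0, 1, 0)"] by (simp add: zero_prod_def)
    then show "j = k \<and> z = w"
      using \<open>z \<in> Z2\<close> \<open>w \<in> Z2\<close> by (auto simp: Z2_def fun_eq_iff)
  qed
  moreover have "?\<Theta> ` (F4 \<times> Z2) = E7_fix2"
  proof
    show "?\<Theta> ` (F4 \<times> Z2) \<subseteq> E7_fix2" using range by auto
    show "E7_fix2 \<subseteq> ?\<Theta> ` (F4 \<times> Z2)"
    proof
      fix \<alpha> assume "\<alpha> \<in> E7_fix2"
      then obtain k where "k \<in> F4" "\<alpha> = flift k \<or> \<alpha> = uminus \<circ> flift k"
        by (rule E7_fix2_cases)
      then have "\<alpha> = ?\<Theta> (k, id) \<or> \<alpha> = ?\<Theta> (k, uminus)" by simp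
      with \<open>k \<in> F4\<close> show "\<alpha> \<in> ?\<Theta> ` (F4 \<times> Z2)"
        by (force simp: Z2_def)
    qed
  qed
  ultimately show "?\<Theta> \<in> iso (map_group F4 \<times>\<times> map_group Z2) (map_group E7_fix2)"
    using range hom by (auto simp: iso_def hom_def bij_betw_def map_group_def DirProd_def)
qed (auto simp: map_group_def F4_comp Z2_comp)

end
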